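(* As $\varepsilon\to0^+$, $$\mathcal Z_2(1-\varepsilon)=C_2-\gamma-\varepsilon\log\frac1\varepsilon+O(\varepsilon).$$
   Context: $\zeta$ is the Riemann zeta function and $\gamma$ is Euler's constant. For $|z|<1$, $$\mathcal Z_2(z):=\sum_{n=1}^{\infty}\left\{\operatorname{Li}_2\!\left(\frac zn\right)-\frac zn\right\}=\sum_{r=2}^{\infty}\frac{\zeta(r)}{r^2}z^r ,$$ where $\operatorname{Li}_2(z)=\sum_{n\ge1}z^n/n^2$, and $$C_2:=\lim_{n\to\infty}\left(\sum_{k=1}^n \operatorname{Li}_2\!\left(\frac1k\right)-\log n\right).$$ *)

theory Defs
  imports "HOL-Analysis.Analysis" "HOL-Library.Landau_Symbols"
begin

(* The functions are polymorphic so that the same definition serves real and complex arguments.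
   Series indexed by n >= 1 are written with Suc n. *)

definition Li2 :: "'a :: {real_normed_field, banach} \<Rightarrow> 'a" where
  "Li2 z = (\<Sum>n. z ^ Suc n / of_nat (Suc n) ^ 2)"

definition Z2 :: "'a :: {real_normed_field, banach} \<Rightarrow> 'a" where
  "Z2 z = (\<Sum>n. Li2 (z / of_nat (Suc n)) - z / of_nat (Suc n))"

definition C2 :: real where
  "C2 = lim (\<lambda>n. (\<Sum>k=1..n. Li2 (1 / real k)) - ln (real n))"

end

theory Submission
  imports Defs "HOL-Real_Asymp.Real_Asymp"
begin

text \<open>Since \<open>C2 - euler_mascheroni = Z2 1\<close>, the claim concerns the increment of \<open>Z2\<close> at 1.
  The increments of the summands with \<open>n \<ge> 2\<close> are bounded by \<open>2 * \<epsilon> / n\<^sup>2\<close>, so only the summand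
  \<open>Li2 z - z\<close> matters. As \<open>Li2' x = - ln (1 - x) / x\<close>, the function
  \<open>Li2 1 - Li2 (1 - \<epsilon>) + \<epsilon> * ln \<epsilon>\<close> has bounded derivative near 0 and tends to 0.\<close>

section \<open>The series for \<open>Li2\<close> and \<open>Z2\<close> on the closed interval [0,1],
  and the value of \<open>Z2\<close> at 1\<close>

lemma summable_inverse_squares: "summable (\<lambda>n. 1 / real (Suc n) ^ 2)"
  using inverse_squares_sums by (simp add: sums_iff add.commute)

lemma summable_Li2:
  fixes x :: real
  assumes "0 \<le> x" "x \<le> 1"
  shows "summable (\<lambda>n. x ^ Suc n / of_nat (Suc n) ^ 2)"
proof (rule summable_comparison_test')
  show "summable (\<lambda>n. 1 / real (Suc n) ^ 2)"
    by (rule summable_inverse_squares)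
  show "norm (x ^ Suc n / of_nat (Suc n) ^ 2) \<le> 1 / real (Suc n) ^ 2" for n
  proof -
    have "x ^ Suc n \<le> 1" using assms by (intro power_le_one) auto
    then show ?thesis using assms by (simp add: divide_right_mono del: power_Suc)
  qed
qed

lemma Li2_minus_id_sums:
  fixes x :: real
  assumes "0 \<le> x" "x \<le> 1"
  shows "(\<lambda>n. x ^ (n + 2) / of_nat (n + 2) ^ 2) sums (Li2 x - x)"
proof -
  have "(\<lambda>n. x ^ Suc n / of_nat (Suc n) ^ 2) sums Li2 x"
    unfolding Li2_def using summable_Li2[OF assms] by (rule summable_sums)
  then show ?thesis
    using sums_Suc_iff[of "\<lambda>n. x ^ Suc n / of_nat (Suc n) ^ 2" "Li2 x - x"] by simp
qed

lemma Li2_minus_id_nonneg: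
  fixes x :: real
  assumes "0 \<le> x" "x \<le> 1"
  shows "0 \<le> Li2 x - x"
  using sums_le[OF _ sums_zero Li2_minus_id_sums[OF assms]] assms by simp

text \<open>Every exponent is at least 2, so \<open>x\<^sup>2\<close> factors out of each term and
  the remaining power is at most 1. Applied to z/n, this makes the outer series of \<open>Z2\<close>
  converge like the sum of 1/n^2, even at the endpoint z = 1.\<close>

lemma Li2_minus_id_le:
  fixes x :: real
  assumes "0 \<le> x" "x \<le> 1"
  shows "Li2 x - x \<le> (Li2 1 - 1) * x\<^sup>2"
proof (rule sums_le[OF _ Li2_minus_id_sums[OF assms] sums_mult2])
  show "(\<lambda>n. 1 ^ (n + 2) / of_nat (n + 2) ^ 2) sums (Li2 1 - 1 :: real)"
    by (rule Li2_minus_id_sums) auto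
  show "x ^ (n + 2) / of_nat (n + 2) ^ 2 \<le> 1 ^ (n + 2) / of_nat (n + 2) ^ 2 * x\<^sup>2" for n
  proof -
    have "x ^ n * x\<^sup>2 \<le> 1 * x\<^sup>2"
      using assms by (intro mult_right_mono power_le_one) auto
    then have "x ^ (n + 2) / of_nat (n + 2) ^ 2 \<le> x\<^sup>2 / of_nat (n + 2) ^ 2"
      unfolding power_add by (intro divide_right_mono) auto
    then show ?thesis by simp
  qed
qed

lemma summable_Z2:
  fixes x :: real
  assumes "0 \<le> x" "x \<le> 1"
  shows "summable (\<lambda>n. Li2 (x / of_nat (Suc n)) - x / of_nat (Suc n))"
proof (rule summable_comparison_test')
  show "summable (\<lambda>n. (Li2 1 - 1) * (1 / real (Suc n) ^ 2))"
    by (intro summable_mult summable_inverse_squares)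
  show "norm (Li2 (x / of_nat (Suc n)) - x / of_nat (Suc n)) \<le> (Li2 1 - 1) * (1 / real (Suc n) ^ 2)" for n
  proof -
    define y where "y = x / of_nat (Suc n)"
    have y: "0 \<le> y" "y \<le> 1" "y \<le> 1 / real (Suc n)"
      using assms by (auto simp: y_def divide_simps)
    have "y\<^sup>2 \<le> (1 / real (Suc n))\<^sup>2" using y by (intro power_mono)
    moreover have "0 \<le> Li2 1 - (1::real)" by (rule Li2_minus_id_nonneg) auto
    ultimately have "(Li2 1 - 1) * y\<^sup>2 \<le> (Li2 1 - 1) * (1 / real (Suc n))\<^sup>2"
      by (intro mult_left_mono)
    then show ?thesis
      using Li2_minus_id_le[OF y(1,2)] Li2_minus_id_nonneg[OF y(1,2)]
      by (simp add: y_def[symmetric] power_divide del: of_nat_Suc)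
  qed
qed

text \<open>The partial sums of \<open>Z2 1\<close> differ from the sums in \<open>C2\<close> by
  harmonic numbers; adding \<open>harm n - ln (real n)\<close>, which tends to Euler's constant,
  turns one into the other. This also proves that the limit behind \<open>C2\<close> exists.\<close>

lemma Z2_one: "Z2 1 = C2 - euler_mascheroni"
proof -
  have "(\<lambda>n. (\<Sum>k<n. Li2 (1 / of_nat (Suc k)) - 1 / of_nat (Suc k))) \<longlonglongrightarrow> (Z2 1 :: real)"
    unfolding Z2_def using summable_LIMSEQ[OF summable_Z2[of 1]] by simp
  from tendsto_add[OF this euler_mascheroni_LIMSEQ]
  have "(\<lambda>n. (\<Sum>k=1..n. Li2 (1 / real k)) - ln (real n)) \<longlonglongrightarrow> Z2 1 + euler_mascheroni"
  proof (rule Lim_transform_eventually, intro always_eventually allI)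
    fix n
    have "(\<Sum>k=1..n. Li2 (1 / real k)) = (\<Sum>k<n. Li2 (1 / real (Suc k)))"
      by (rule sum.reindex_bij_witness[of _ Suc "\<lambda>k. k - 1"]) auto
    moreover have "harm n = (\<Sum>k<n. 1 / real (Suc k))"
      unfolding harm_def
      by (rule sum.reindex_bij_witness[of _ Suc "\<lambda>k. k - 1"]) (auto simp: divide_inverse)
    ultimately show "(\<Sum>k<n. Li2 (1 / of_nat (Suc k)) - 1 / of_nat (Suc k)) + (harm n - ln (real n))
        = (\<Sum>k=1..n. Li2 (1 / real k)) - ln (real n)"
      by (simp add: sum_subtractf)
  qed
  then show ?thesis unfolding C2_def by (simp add: limI)
qed

section \<open>Increments of the summands with n at least 2\<close>

lemma one_minus_power_le:
  fixes \<epsilon> :: real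
  assumes "0 \<le> \<epsilon>" "\<epsilon> \<le> 1"
  shows "1 - (1 - \<epsilon>) ^ n \<le> real n * \<epsilon>"
  using Bernoulli_inequality[of "-\<epsilon>" n] assms by simp

text \<open>Bernoulli's inequality gives a factor \<open>real (n + 2) * \<epsilon>\<close>, which
  cancels one power of the squared denominator. The rest is dominated by a geometric series of ratio
  1/2, whose sum is the constant 2.\<close>

lemma Li2_minus_id_increment_le:
  fixes x \<epsilon> :: real
  assumes "0 \<le> x" "x \<le> 1 / 2" "0 \<le> \<epsilon>" "\<epsilon> \<le> 1"
  shows "(Li2 x - x) - (Li2 ((1 - \<epsilon>) * x) - (1 - \<epsilon>) * x) \<le> \<epsilon> * (x\<^sup>2 * 2)"
proof (rule sums_le)
  have "(1 - \<epsilon>) * x \<le> 1 * x" using assms by (intro mult_right_mono) auto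
  then show "(\<lambda>n. x ^ (n + 2) / of_nat (n + 2) ^ 2
      - ((1 - \<epsilon>) * x) ^ (n + 2) / of_nat (n + 2) ^ 2) sums
      ((Li2 x - x) - (Li2 ((1 - \<epsilon>) * x) - (1 - \<epsilon>) * x))"
    using assms by (intro sums_diff Li2_minus_id_sums) auto
  show "(\<lambda>n. \<epsilon> * (x\<^sup>2 * (1 / 2) ^ n)) sums (\<epsilon> * (x\<^sup>2 * 2))"
    using geometric_sums[of "1 / 2 :: real"] by (intro sums_mult) simp
  show "x ^ (n + 2) / of_nat (n + 2) ^ 2 - ((1 - \<epsilon>) * x) ^ (n + 2) / of_nat (n + 2) ^ 2
      \<le> \<epsilon> * (x\<^sup>2 * (1 / 2) ^ n)" for n
  proof -
    have "x ^ (n + 2) / of_nat (n + 2) ^ 2 - ((1 - \<epsilon>) * x) ^ (n + 2) / of_nat (n + 2) ^ 2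
        = (1 - (1 - \<epsilon>) ^ (n + 2)) * (x ^ (n + 2) / real (n + 2) ^ 2)"
      unfolding power_mult_distrib by (simp only: left_diff_distrib diff_divide_distrib times_divide_eq_right mult_1)
    also have "\<dots> \<le> (real (n + 2) * \<epsilon>) * (x ^ (n + 2) / real (n + 2) ^ 2)"
      using assms by (intro mult_right_mono one_minus_power_le) auto
    also have "\<dots> = \<epsilon> * (x ^ (n + 2) / real (n + 2))"
      by (simp add: power2_eq_square del: of_nat_add)
    also have "x ^ (n + 2) / real (n + 2) \<le> x ^ (n + 2)"
      using assms divide_left_mono[of 1 "real (n + 2)" "x ^ (n + 2)"] by simp
    also have "x ^ (n + 2) \<le> x\<^sup>2 * (1 / 2) ^ n"
      unfolding add.commute[of n] power_add using assms by (intro mult_left_mono power_mono) auto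
    finally show ?thesis using assms by (simp add: mult_left_mono)
  qed
qed

lemma Li2_minus_id_mono:
  fixes x y :: real
  assumes "0 \<le> x" "x \<le> y" "y \<le> 1"
  shows "Li2 x - x \<le> Li2 y - y"
  by (rule sums_le[OF _ Li2_minus_id_sums Li2_minus_id_sums])
     (use assms in \<open>auto intro!: divide_right_mono power_mono simp del: power_Suc\<close>)

text \<open>Without the summand n = 1, the arguments 1/2, 1/3, ... all lie in the range where the
  increment bound is linear in \<open>\<epsilon>\<close>. Monotonicity gives the lower bound
  0.\<close>

lemma Z2_tail_increment_le:
  fixes \<epsilon> :: real
  assumes "0 \<le> \<epsilon>" "\<epsilon> \<le> 1"
  shows "\<bar>(Z2 1 - (Li2 1 - 1)) - (Z2 (1 - \<epsilon>) - (Li2 (1 - \<epsilon>) - (1 - \<epsilon>)))\<bar>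
    \<le> \<epsilon> * (\<Sum>n. 2 / real (Suc (Suc n)) ^ 2)"
proof -
  define g where "g = (\<lambda>x::real. Li2 x - x)"
  have tail: "(\<lambda>n. g (z / of_nat (Suc (Suc n)))) sums (Z2 z - g z)" if "0 \<le> z" "z \<le> 1" for z
  proof -
    have "(\<lambda>n. g (z / of_nat (Suc n))) sums Z2 z"
      unfolding Z2_def g_def using summable_Z2[OF that] by (rule summable_sums)
    then show ?thesis
      using sums_Suc_iff[of "\<lambda>n. g (z / of_nat (Suc n))" "Z2 z - g z"] by simp
  qed
  have D: "(\<lambda>n. g (1 / of_nat (Suc (Suc n))) - g ((1 - \<epsilon>) / of_nat (Suc (Suc n)))) sums
      ((Z2 1 - g 1) - (Z2 (1 - \<epsilon>) - g (1 - \<epsilon>)))"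
    using assms by (intro sums_diff tail) auto
  have "summable (\<lambda>n. 2 * (1 / real (Suc (Suc n)) ^ 2))"
    using summable_inverse_squares by (intro summable_mult) (subst (asm) summable_Suc_iff[symmetric])
  then have S: "(\<lambda>n. \<epsilon> * (2 / real (Suc (Suc n)) ^ 2)) sums (\<epsilon> * (\<Sum>n. 2 / real (Suc (Suc n)) ^ 2))"
    by (intro sums_mult summable_sums) simp
  have "0 \<le> (Z2 1 - g 1) - (Z2 (1 - \<epsilon>) - g (1 - \<epsilon>))"
  proof (rule sums_le[OF _ sums_zero D])
    fix n
    show "0 \<le> g (1 / of_nat (Suc (Suc n))) - g ((1 - \<epsilon>) / of_nat (Suc (Suc n)))"
      using Li2_minus_id_mono[of "(1 - \<epsilon>) / of_nat (Suc (Suc n))" "1 / of_nat (Suc (Suc n))"] assms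
      by (simp add: g_def divide_right_mono)
  qed
  moreover have "(Z2 1 - g 1) - (Z2 (1 - \<epsilon>) - g (1 - \<epsilon>)) \<le> \<epsilon> * (\<Sum>n. 2 / real (Suc (Suc n)) ^ 2)"
  proof (rule sums_le[OF _ D S])
    fix n
    show "g (1 / of_nat (Suc (Suc n))) - g ((1 - \<epsilon>) / of_nat (Suc (Suc n)))
        \<le> \<epsilon> * (2 / real (Suc (Suc n)) ^ 2)"
      using Li2_minus_id_increment_le[of "1 / real (Suc (Suc n))" \<epsilon>] assms
      by (simp add: g_def power_divide)
  qed
  ultimately show ?thesis by (simp add: g_def)
qed

section \<open>The logarithmic singularity of the derivative of \<open>Li2\<close> at 1\<close>

lemma Li2_has_field_derivative:
  fixes x :: real
  assumes "0 < x" "x < 1"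
  shows "(Li2 has_field_derivative (- ln (1 - x) / x)) (at x)"
proof -
  \<comment> \<open>Since division by zero yields 0, \<open>c 0 = 0\<close>: the power series has no
    constant term and matches the shifted series of \<open>Li2\<close>.\<close>
  define c where "c = (\<lambda>n. 1 / real n ^ 2)"
  have sm: "summable (\<lambda>n. c n * y ^ n)" if "0 \<le> y" "y \<le> 1" for y
    using summable_Li2[OF that] by (subst summable_Suc_iff[symmetric]) (simp add: c_def)
  have Li2_eq: "Li2 y = (\<Sum>n. c n * y ^ n)" if "0 \<le> y" "y \<le> 1" for y
    using suminf_split_head[OF sm[OF that]] by (simp add: c_def Li2_def)
  have "((\<lambda>y. \<Sum>n. c n * y ^ n) has_field_derivative (\<Sum>n. diffs c n * x ^ n)) (at x)"
    using assms sm[of 1] by (intro termdiffs_strong[where K = 1]) auto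
  \<comment> \<open>Here \<open>diffs c n\<close> is 1/(n+1), so multiplication by \<open>x\<close>
    produces the series of \<open>- ln (1 - x)\<close>.\<close>
  moreover have "(\<Sum>n. diffs c n * x ^ n) = - ln (1 - x) / x"
  proof -
    have "summable (\<lambda>n. diffs c n * x ^ n)"
      using assms sm[of 1] by (intro termdiff_converges[where K = 1])
        (auto intro!: summable_comparison_test'[OF sm[of "\<bar>_\<bar>"]] simp: c_def abs_mult power_abs)
    then have S: "(\<lambda>n. diffs c n * x ^ n * x) sums ((\<Sum>n. diffs c n * x ^ n) * x)"
      by (intro sums_mult2 summable_sums)
    have "ln (1 - x) = (\<Sum>n. (-1) ^ n * (1 / real (n + 1)) * ((1 - x) - 1) ^ Suc n)"
      using assms by (intro ln_series) auto
    also have "\<dots> = (\<Sum>n. - (diffs c n * x ^ n * x))"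
    proof (rule suminf_cong)
      fix n
      have "(-1) ^ n * (- x) ^ n = x ^ n" by (simp flip: power_mult_distrib)
      then show "(-1) ^ n * (1 / real (n + 1)) * ((1 - x) - 1) ^ Suc n = - (diffs c n * x ^ n * x)"
        by (simp add: diffs_def c_def power2_eq_square)
    qed
    also have "\<dots> = - ((\<Sum>n. diffs c n * x ^ n) * x)"
      using sums_minus[OF S] by (rule sums_unique[symmetric])
    finally show ?thesis using assms by (simp add: field_simps)
  qed
  ultimately have "((\<lambda>y. \<Sum>n. c n * y ^ n) has_field_derivative (- ln (1 - x) / x)) (at x)"
    by simp
  then show ?thesis
  \<comment> \<open>\<open>Li2_eq\<close> covers [0,1]; the open interval (0,1) is a neighbourhood
    of \<open>x\<close> inside it.\<close>
  proof (rule has_field_derivative_transform_within_open)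
    show "open {0<..<1::real}" "x \<in> {0<..<1}" using assms by auto
  qed (simp add: Li2_eq)
qed

lemma continuous_on_Li2: "continuous_on {0..1} (Li2 :: real \<Rightarrow> real)"
proof -
  have "uniform_limit {0..1} (\<lambda>n x. \<Sum>i<n. x ^ Suc i / of_nat (Suc i) ^ 2)
      (\<lambda>x::real. \<Sum>i. x ^ Suc i / of_nat (Suc i) ^ 2) sequentially"
  proof (rule Weierstrass_m_test)
    show "summable (\<lambda>n. 1 / real (Suc n) ^ 2)" by (rule summable_inverse_squares)
    show "norm (x ^ Suc n / of_nat (Suc n) ^ 2) \<le> 1 / real (Suc n) ^ 2" if "x \<in> {0..1}" for n and x :: real
      using that power_le_one[of x "Suc n"] by (simp add: divide_right_mono del: power_Suc)
  qed
  then show ?thesis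
    unfolding Li2_def
    by (rule uniform_limit_theorem[rotated])
       (auto intro!: always_eventually continuous_intros simp del: of_nat_Suc)
qed

text \<open>Adding \<open>t * ln t\<close> cancels the unbounded logarithm in the derivative of
  \<open>- Li2 (1 - t)\<close>, up to a bounded remainder. The mean value inequality then gives a
  linear bound.\<close>

lemma Li2_at_one_bound:
  fixes \<epsilon> :: real
  assumes "0 < \<epsilon>" "\<epsilon> < 1 / 2"
  shows "\<bar>Li2 1 - Li2 (1 - \<epsilon>) + \<epsilon> * ln \<epsilon>\<bar> \<le> 3 * \<epsilon>"
proof -
  define h where "h = (\<lambda>t::real. Li2 1 - Li2 (1 - t) + t * ln t)"
  have der: "(h has_field_derivative (1 - t * ln t / (1 - t))) (at t within {0<..<1/2})"
    if "t \<in> {0<..<1/2}" for t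
  proof -
    have "(Li2 has_field_derivative (- ln (1 - (1 - t)) / (1 - t))) (at (1 - t))"
      using that by (intro Li2_has_field_derivative) auto
    then have "((\<lambda>t. Li2 (1 - t)) has_field_derivative (- ln t / (1 - t)) * (-1)) (at t)"
      by (intro DERIV_chain2[where f = Li2 and g = "\<lambda>t. 1 - t"] derivative_eq_intros) auto
    then have "(h has_field_derivative (0 - (- ln t / (1 - t)) * (-1) + (1 * ln t + inverse t * t))) (at t)"
      unfolding h_def using that by (intro DERIV_add DERIV_diff DERIV_mult DERIV_ln) auto
    moreover have "0 - (- ln t / (1 - t)) * (-1) + (1 * ln t + inverse t * t) = 1 - t * ln t / (1 - t)"
      using that by (simp add: field_simps)
    ultimately show ?thesis by (simp add: has_field_derivative_at_within)
  qed
  \<comment> \<open>The constant is 1 + 1 * 2: \<open>- (t * ln t)\<close> lies between 0 and 1, and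
    1/(1-t) is at most 2.\<close>
  have der_bound: "norm (1 - t * ln t / (1 - t)) \<le> 3" if "t \<in> {0<..<1/2}" for t :: real
  proof -
    have "ln (1 / t) \<le> 1 / t - 1" using that by (intro ln_le_minus_one) auto
    then have "- (t * ln t) \<le> 1"
      using that by (simp add: ln_div field_simps)
    moreover have "t * ln t \<le> 0" using that by (simp add: mult_nonneg_nonpos)
    ultimately show ?thesis using that by (simp add: abs_if field_simps)
  qed
  have "((\<lambda>t. Li2 (1 - t)) \<longlongrightarrow> (Li2 1 :: real)) (at_right 0)"
  proof -
    have "(Li2 \<longlongrightarrow> (Li2 1 :: real)) (at 1 within {0..1})"
      using continuous_on_Li2 by (simp add: continuous_on_def)
    moreover have "filterlim (\<lambda>t::real. 1 - t) (at 1 within {0..1}) (at_right 0)"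
    proof -
      have "\<forall>\<^sub>F t::real in at_right 0. t \<in> {0<..<1}" by (rule eventually_at_right_real) simp
      then show ?thesis
        unfolding filterlim_at
        by (auto elim!: eventually_mono intro!: tendsto_eq_intros)
    qed
    ultimately show ?thesis by (rule filterlim_compose)
  qed
  moreover have "((\<lambda>t::real. t * ln t) \<longlongrightarrow> 0) (at_right 0)" by real_asymp
  ultimately have "(h \<longlongrightarrow> Li2 1 - Li2 1 + 0) (at_right 0)"
    unfolding h_def by (intro tendsto_intros)
  \<comment> \<open>The derivative is controlled only on the open interval, so
    \<open>h \<epsilon>\<close> is compared with \<open>h t\<close> there and then t tends to 0 from
    the right.\<close>
  then have "((\<lambda>t. \<bar>h \<epsilon> - h t\<bar>) \<longlongrightarrow> \<bar>h \<epsilon> - 0\<bar>) (at_right 0)"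
    by (intro tendsto_intros) simp
  moreover have "((\<lambda>t. 3 * \<bar>\<epsilon> - t\<bar>) \<longlongrightarrow> 3 * \<bar>\<epsilon> - 0\<bar>) (at_right 0)"
    by (intro tendsto_intros)
  moreover have "\<forall>\<^sub>F t in at_right 0. \<bar>h \<epsilon> - h t\<bar> \<le> 3 * \<bar>\<epsilon> - t\<bar>"
    using eventually_at_right_real[of 0 "1/2"]
  proof (rule eventually_mono)
    fix t :: real assume "t \<in> {0<..<1/2}"
    then show "\<bar>h \<epsilon> - h t\<bar> \<le> 3 * \<bar>\<epsilon> - t\<bar>"
      using field_differentiable_bound[of "{0<..<1/2}" h, OF _ der der_bound] assms by auto
  qed simp
  ultimately have "\<bar>h \<epsilon> - 0\<bar> \<le> 3 * \<bar>\<epsilon> - 0\<bar>"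
    by (intro tendsto_le[OF trivial_limit_at_right_real])
  then show ?thesis using assms by (simp add: h_def)
qed

theorem mainTheorem4:
  shows "(\<lambda>\<epsilon>::real. Z2 (1 - \<epsilon>) - (C2 - euler_mascheroni - \<epsilon> * ln (1 / \<epsilon>)))
           \<in> O[at_right 0](\<lambda>\<epsilon>. \<epsilon>)"
proof (rule bigoI)
  \<comment> \<open>In the constant \<open>K + 4\<close>, \<open>K\<close> comes from the summands
    with n at least 2, 3 from \<open>Li2_at_one_bound\<close>, and 1 from the linear term of
    \<open>Li2 z - z\<close>.\<close>
  define K where "K = (\<Sum>n. 2 / real (Suc (Suc n)) ^ 2)"
  show "\<forall>\<^sub>F \<epsilon>::real in at_right 0.
      norm (Z2 (1 - \<epsilon>) - (C2 - euler_mascheroni - \<epsilon> * ln (1 / \<epsilon>))) \<le> (K + 4) * norm \<epsilon>"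
    using eventually_at_right_real[of 0 "1/2"]
  proof (rule eventually_mono)
    fix \<epsilon> :: real assume "\<epsilon> \<in> {0<..<1/2}"
    then have \<epsilon>: "0 < \<epsilon>" "\<epsilon> < 1 / 2" by auto
    have "\<bar>(Z2 1 - (Li2 1 - 1)) - (Z2 (1 - \<epsilon>) - (Li2 (1 - \<epsilon>) - (1 - \<epsilon>)))\<bar> \<le> K * \<epsilon>"
      using Z2_tail_increment_le[of \<epsilon>] \<epsilon> by (simp add: K_def mult.commute)
    moreover have "\<epsilon> * ln (1 / \<epsilon>) = - (\<epsilon> * ln \<epsilon>)"
      using \<epsilon> by (simp add: ln_div)
    ultimately show "norm (Z2 (1 - \<epsilon>) - (C2 - euler_mascheroni - \<epsilon> * ln (1 / \<epsilon>))) \<le> (K + 4) * norm \<epsilon>"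
      using Li2_at_one_bound[OF \<epsilon>] \<epsilon>
      unfolding Z2_one[symmetric] real_norm_def distrib_right by linarith
  qed simp
qed

end
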